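(* Let $B$ be a polynomial with complex coefficients of degree at least two. For any $X_1,X_2\in\mathcal{E}(B)$ there exists $X\in\mathcal{E}(B)$ such that $\deg X=\mathrm{lcm}(\deg X_1,\deg X_2)$ and $X=U_1\circ X_1=U_2\circ X_2$ for some polynomials $U_1,U_2$. Furthermore, there exists $W\in\mathcal{E}(B)$ such that $\deg W=\gcd(\deg X_1,\deg X_2)$ and $X_1=V_1\circ W$, $X_2=V_2\circ W$ for some polynomials $V_1,V_2$.
   Context: All polynomials have complex coefficients. For a fixed polynomial $B$ of degree at least two, $\mathcal{E}(B)$ denotes the set of polynomials $X$ of degree at least two for which there exists a polynomial $A$ with $A\circ X=X\circ B$.
   Formalization: When gcd(deg X_1, deg X_2) = 1 no W in E(B) can have that degree (e.g. B=z^6, X_1=z^2, X_2=z^3); W ∈ E(B) is therefore claimed only for gcd ≥ 2, while A∘W = W∘B for some A, deg W = gcd and X_i = V_i∘W are claimed in all cases. *)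

theory Defs
  imports Complex_Main "HOL-Computational_Algebra.Computational_Algebra"
begin

(* The bound on the degree excludes linear X, for which A = X o B o X^(-1) always exists. *)
definition E_set :: "complex poly \<Rightarrow> complex poly set" where
  "E_set B = {X. degree X \<ge> 2 \<and> (\<exists>A. A \<circ>\<^sub>p X = X \<circ>\<^sub>p B)}"

end

theory Submission
  imports Defs "HOL-Computational_Algebra.Field_as_Ring"
begin

text \<open>
  Let n be the degree of B. Near infinity B is conjugate to the n-th power map: there is a formal
  series \<gamma>(t) with leading term a multiple of t and B(\<gamma>(t)) = \<gamma>(t^n)
  (lemma boettcher_coordinate_exists). In this coordinate the functional equation becomes a condition
  on exponents. A polynomial X of degree d > 0 satisfies A o X = X o B for some A if and only if
  X(\<gamma>(t)) is a Laurent series in t^d, that is, if and only if it is invariant under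
  t \<mapsto> s t for every d-th root of unity s (lemma semiconjugacy_iff_supported_on_multiples).
  Moreover, every polynomial P for which P(\<gamma>(t)) is a series in t^d is then a polynomial in X
  (lemma decomposition_of_supported_on_multiples). It therefore suffices to find, for the greatest
  common divisor g and for the least common multiple l of the two degrees, polynomials of degree g
  and l with the corresponding support.

  The invariance says that the solutions y of X(y) = X(\<gamma>(t)) are exactly the \<gamma>(s t) with
  s^d = 1 (lemma fiber_poly_factorization). For g, take the common solutions for X1 and X2: these are
  the \<gamma>(s t) with s^g = 1, and their product is, up to a constant, a polynomial in \<gamma>(t),
  because it comes from the greatest common divisor of X1(y) - X1(z) and X2(y) - X2(z)
  (lemma gcd_degree_polynomial).

  For l, suppose first that the degrees are coprime. The product of X1(\<gamma>(s t)) over the s with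
  s^(deg X2) = 1 is invariant under both groups of roots of unity, and it is a polynomial in
  X2(\<gamma>(t)) because it is a norm (lemma coprime_degree_product_polynomial). The general case is
  reduced to the coprime one by cancelling the common right factor of degree g
  (lemma lcm_of_semiconjugacies).
\<close>

unbundle fps_syntax

section \<open>Evaluating polynomials at Laurent series\<close>

text \<open>
  Series are expanded at infinity: the formal variable stands for 1/t, so a series whose leading
  term is a multiple of t^d has subdegree -d.
\<close>

definition laurent_eval :: "complex fls \<Rightarrow> complex poly \<Rightarrow> complex fls" where
  "laurent_eval f p = poly (map_poly fls_const p) f"

lemma laurent_eval_0 [simp]: "laurent_eval f 0 = 0"
  and laurent_eval_1 [simp]: "laurent_eval f 1 = 1"
  by (simp_all add: laurent_eval_def)

lemma laurent_eval_pCons: "laurent_eval f (pCons a p) = fls_const a + f * laurent_eval f p"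
  by (simp add: laurent_eval_def map_poly_pCons)

lemma laurent_eval_const [simp]: "laurent_eval f [:a:] = fls_const a"
  by (simp add: laurent_eval_pCons)

lemma map_poly_add_hom:
  assumes "h 0 = 0" "\<And>a b. h (a + b) = h a + h b"
  shows "map_poly h (p + q) = map_poly h p + map_poly h q"
  by (intro poly_eqI) (simp add: coeff_map_poly assms)

lemma map_poly_mult_hom:
  fixes h :: "'a::comm_semiring_0 \<Rightarrow> 'b::comm_semiring_0"
  assumes "h 0 = 0" "\<And>a b. h (a + b) = h a + h b" "\<And>a b. h (a * b) = h a * h b"
  shows "map_poly h (p * q) = map_poly h p * map_poly h q"
proof (induction p)
  case (pCons a p)
  have "map_poly h (smult a q) = smult (h a) (map_poly h q)"
    using assms by (intro map_poly_smult) auto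
  with pCons.IH show ?case
    using assms by (simp add: map_poly_add_hom map_poly_pCons)
qed simp

lemma laurent_eval_add: "laurent_eval f (p + q) = laurent_eval f p + laurent_eval f q"
  by (simp add: laurent_eval_def map_poly_add_hom fls_plus_const)

lemma laurent_eval_mult: "laurent_eval f (p * q) = laurent_eval f p * laurent_eval f q"
  by (simp add: laurent_eval_def map_poly_mult_hom fls_plus_const)

lemma laurent_eval_uminus: "laurent_eval f (- p) = - laurent_eval f p"
  using laurent_eval_add[of f p "- p"] by (simp add: add_eq_0_iff)

lemma laurent_eval_diff: "laurent_eval f (p - q) = laurent_eval f p - laurent_eval f q"
  using laurent_eval_add[of f p "- q"] by (simp add: laurent_eval_uminus)

lemma laurent_eval_smult: "laurent_eval f (smult c p) = fls_const c * laurent_eval f p"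
  using laurent_eval_mult[of f "[:c:]" p] by simp

lemma laurent_eval_prod_mset:
  "laurent_eval f (\<Prod>x\<in>#A. g x) = (\<Prod>x\<in>#A. laurent_eval f (g x))"
  by (induction A) (simp_all add: laurent_eval_mult)

lemma laurent_eval_pcompose: "laurent_eval f (p \<circ>\<^sub>p q) = laurent_eval (laurent_eval f q) p"
  by (induction p) (simp_all add: pcompose_pCons laurent_eval_pCons laurent_eval_add laurent_eval_mult)

lemma laurent_eval_commute:
  assumes "h 0 = 0" "\<And>a b. h (a + b) = h a + h b" "\<And>a b. h (a * b) = h a * h b"
    "\<And>c. h (fls_const c) = fls_const c"
  shows "h (laurent_eval f p) = laurent_eval (h f) p"
  by (induction p) (simp_all add: laurent_eval_pCons assms)

lemma fls_nth_neg_subdegree_nonzero: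
  assumes "fls_subdegree f = - int d" "d > 0"
  shows "f $$ (- int d) \<noteq> 0"
proof -
  have "f \<noteq> 0" using assms by auto
  from nth_fls_subdegree_nonzero[OF this] show ?thesis by (simp add: assms(1))
qed

lemma laurent_eval_leading:
  assumes "fls_subdegree f = - int d" "d > 0" "p \<noteq> 0"
  shows "fls_subdegree (laurent_eval f p) = - int (d * degree p)"
    and "laurent_eval f p $$ (- int (d * degree p)) = lead_coeff p * (f $$ (- int d)) ^ degree p"
proof -
  have f0: "f \<noteq> 0" "f $$ (- int d) \<noteq> 0"
    using assms(1,2) fls_nth_neg_subdegree_nonzero[of f d] by auto
  have "fls_subdegree (laurent_eval f p) = - int (d * degree p) \<and>
     laurent_eval f p $$ (- int (d * degree p)) = lead_coeff p * (f $$ (- int d)) ^ degree p"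
    using assms(3)
  proof (induction p)
    case (pCons a p)
    show ?case
    proof (cases "p = 0")
      case True
      with pCons.hyps show ?thesis by simp
    next
      case False
      define e where "e = laurent_eval f p"
      have IH: "fls_subdegree e = - int (d * degree p)"
        "e $$ (- int (d * degree p)) = lead_coeff p * (f $$ (- int d)) ^ degree p"
        using pCons.IH False by (auto simp: e_def)
      have e0: "e \<noteq> 0" using IH(2) f0 False by auto
      have ex: "- int (d * degree (pCons a p)) = fls_subdegree f + fls_subdegree e"
        using False by (simp add: IH assms algebra_simps)
      have neg: "fls_subdegree f + fls_subdegree e < 0"
        unfolding IH(1) assms(1) using assms(2) of_nat_0_le_iff[of "d * degree p"] by linarith
      have top: "(fls_const a + f * e) $$ (fls_subdegree f + fls_subdegree e)
          = f $$ fls_subdegree f * e $$ fls_subdegree e"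
        using neg by simp
      have nz: "f $$ fls_subdegree f * e $$ fls_subdegree e \<noteq> 0"
        using f0 e0 by simp
      have "fls_subdegree (fls_const a + f * e) = fls_subdegree f + fls_subdegree e"
        using neg top nz by (intro fls_subdegree_eqI) (auto simp: fls_times_nth_eq0)
      moreover have "(fls_const a + f * e) $$ (- int (d * degree (pCons a p)))
          = lead_coeff (pCons a p) * (f $$ (- int d)) ^ degree (pCons a p)"
        unfolding ex top using False
        by (simp only: IH assms(1)) (simp add: algebra_simps)
      ultimately show ?thesis
        unfolding laurent_eval_pCons e_def[symmetric] ex by simp
    qed
  qed simp
  then show "fls_subdegree (laurent_eval f p) = - int (d * degree p)"
    "laurent_eval f p $$ (- int (d * degree p)) = lead_coeff p * (f $$ (- int d)) ^ degree p"
    by auto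
qed

lemma laurent_eval_eq_0_iff:
  assumes "fls_subdegree f = - int d" "d > 0"
  shows "laurent_eval f p = 0 \<longleftrightarrow> p = 0"
proof -
  have "laurent_eval f p \<noteq> 0" if "p \<noteq> 0"
    using laurent_eval_leading(2)[OF assms that] that fls_nth_neg_subdegree_nonzero[OF assms] by auto
  then show ?thesis by auto
qed

section \<open>Rotations and series in a power of the variable\<close>

text \<open>
  Multiplying the expansion variable 1/t by s replaces t by t/s. The comments nevertheless write the
  rotated series as f(s t): inverting all roots of unity turns one convention into the other.
\<close>

definition rotation :: "complex \<Rightarrow> complex fls \<Rightarrow> complex fls" where
  "rotation s f = fls_compose_fps f (fps_const s * fps_X)"

lemma rotation_nth: "s \<noteq> 0 \<Longrightarrow> rotation s f $$ k = f $$ k * s powi k"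
  by (simp add: rotation_def fls_nth_fls_compose_fps_linear)

lemma rotation_hom:
  assumes "s \<noteq> 0"
  shows "rotation s 0 = 0" "rotation s (f + g) = rotation s f + rotation s g"
    "rotation s (f * g) = rotation s f * rotation s g" "rotation s (fls_const c) = fls_const c"
  using assms by (simp_all add: rotation_def fls_compose_fps_add fls_compose_fps_mult)

lemma rotation_laurent_eval:
  "s \<noteq> 0 \<Longrightarrow> rotation s (laurent_eval f p) = laurent_eval (rotation s f) p"
  by (intro laurent_eval_commute) (simp_all add: rotation_hom)

lemma rotation_prod:
  "s \<noteq> 0 \<Longrightarrow> rotation s (\<Prod>i\<in>I. f i) = (\<Prod>i\<in>I. rotation s (f i))"
  by (induction I rule: infinite_finite_induct) (simp_all add: rotation_hom rotation_hom(4)[of s 1, simplified])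

definition supported_on_multiples :: "nat \<Rightarrow> complex fls \<Rightarrow> bool" where
  "supported_on_multiples d f \<longleftrightarrow> (\<forall>k. f $$ k \<noteq> 0 \<longrightarrow> int d dvd k)"

lemma root_of_unity_power_int_dvd:
  assumes "(s::complex) ^ d = 1" "int d dvd k"
  shows "s powi k = 1"
  using assms by (auto simp: dvd_def power_int_mult)

lemma cis_power_int_eq_1_imp_dvd:
  assumes "d > 0" "cis (2 * pi / real d) powi k = 1"
  shows "int d dvd k"
proof -
  have "cis (of_int k * (2 * pi / real d)) = 1"
    using assms(2) by (simp add: cis_power_int)
  then obtain m :: int where m: "of_int k * (2 * pi / real d) = of_int m * (2 * pi)"
    by (auto simp: complex_eq_iff cos_one_2pi_int mult_ac)
  then have "of_int k = real_of_int m * real d"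
    using assms(1) by (simp add: field_simps)
  then have "k = m * int d"
    by (metis of_int_eq_iff of_int_mult of_int_of_nat_eq)
  then show ?thesis by simp
qed

text \<open>
  A primitive d-th root of unity acts on t^k by a d-th root of unity that is trivial only for
  d | k. The right-hand side is what makes closure under ring operations immediate, because
  rotations are ring homomorphisms; the left-hand side is what the coefficient comparisons use.
\<close>

lemma supported_on_multiples_iff_rotation:
  assumes "d > 0"
  shows "supported_on_multiples d f \<longleftrightarrow> (\<forall>s. s ^ d = 1 \<longrightarrow> rotation s f = f)"
proof
  assume L: "supported_on_multiples d f"
  show "\<forall>s. s ^ d = 1 \<longrightarrow> rotation s f = f"
  proof (intro allI impI fls_eqI)
    fix s :: complex and k assume s: "s ^ d = 1"
    then have "s \<noteq> 0" using assms by (auto simp: power_0_left)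
    then show "rotation s f $$ k = f $$ k"
      using L root_of_unity_power_int_dvd[OF s]
      by (cases "f $$ k = 0") (auto simp: rotation_nth supported_on_multiples_def)
  qed
next
  assume R: "\<forall>s. s ^ d = 1 \<longrightarrow> rotation s f = f"
  define s where "s = cis (2 * pi / real d)"
  have "s ^ d = 1" using assms by (simp add: s_def DeMoivre)
  then have fixed: "rotation s f = f" using R by blast
  have "s \<noteq> 0" by (simp add: s_def)
  show "supported_on_multiples d f"
    unfolding supported_on_multiples_def
  proof (intro allI impI)
    fix k assume "f $$ k \<noteq> 0"
    moreover have "f $$ k * s powi k = f $$ k"
      using fixed rotation_nth[OF \<open>s \<noteq> 0\<close>, of f k] by simp
    ultimately show "int d dvd k"
      using cis_power_int_eq_1_imp_dvd[OF assms] by (simp add: s_def)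
  qed
qed

lemma supported_on_multiples_laurent_eval:
  assumes "d > 0" "supported_on_multiples d f"
  shows "supported_on_multiples d (laurent_eval f p)"
  unfolding supported_on_multiples_iff_rotation[OF assms(1)]
proof (intro allI impI)
  fix s :: complex assume "s ^ d = 1"
  moreover from this have "s \<noteq> 0" using assms(1) by (auto simp: power_0_left)
  ultimately show "rotation s (laurent_eval f p) = laurent_eval f p"
    using assms by (simp add: rotation_laurent_eval supported_on_multiples_iff_rotation)
qed

lemma supported_on_multiples_diff:
  "supported_on_multiples d f \<Longrightarrow> supported_on_multiples d g \<Longrightarrow> supported_on_multiples d (f - g)"
  by (auto simp: supported_on_multiples_def)
    (metis diff_0_right)

lemma supported_on_multiples_prod:
  assumes "d > 0" "\<And>i. i \<in> I \<Longrightarrow> supported_on_multiples d (f i)"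
  shows "supported_on_multiples d (\<Prod>i\<in>I. f i)"
  unfolding supported_on_multiples_iff_rotation[OF assms(1)]
proof (intro allI impI)
  fix s :: complex assume "s ^ d = 1"
  moreover from this have "s \<noteq> 0" using assms(1) by (auto simp: power_0_left)
  ultimately show "rotation s (\<Prod>i\<in>I. f i) = (\<Prod>i\<in>I. f i)"
    using assms by (simp add: rotation_prod supported_on_multiples_iff_rotation)
qed

lemma supported_on_multiples_rotation:
  "s \<noteq> 0 \<Longrightarrow> supported_on_multiples d f \<Longrightarrow> supported_on_multiples d (rotation s f)"
  by (simp add: supported_on_multiples_def rotation_nth)

lemma supported_on_multiples_compose_power:
  assumes "n > 0" "supported_on_multiples d f"
  shows "supported_on_multiples d (fls_compose_power f n)"
  using assms by (auto simp: supported_on_multiples_def fls_nth_compose_power split: if_splits)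

lemma supported_on_multiples_dvd:
  "e dvd d \<Longrightarrow> supported_on_multiples d f \<Longrightarrow> supported_on_multiples e f"
  unfolding supported_on_multiples_def by (meson dvd_trans int_dvd_int_iff)

lemma supported_on_multiples_coprime:
  "coprime a b \<Longrightarrow> supported_on_multiples a f \<Longrightarrow> supported_on_multiples b f \<Longrightarrow>
    supported_on_multiples (a * b) f"
  by (simp add: supported_on_multiples_def divides_mult)

section \<open>Solutions of a semiconjugacy equation are series in a power of the variable\<close>

text \<open>
  The formal analogue of the mean value theorem: when f and g have the same leading term a t^d, the
  quotient of p(f) - p(g) by f - g has the leading term of p'(f). Both the rigidity statement below
  and the construction of the Boettcher coordinate rest on knowing this leading term exactly.
\<close>

lemma laurent_eval_difference_quotient:
  assumes "fls_subdegree f = - int d" "fls_subdegree g = - int d" "d > 0"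
    and lead: "f $$ (- int d) = a" "g $$ (- int d) = a"
    and "degree p > 0"
  obtains Q where "laurent_eval f p - laurent_eval g p = (f - g) * Q"
    "fls_subdegree Q = - int (d * (degree p - 1))"
    "Q $$ (- int (d * (degree p - 1))) = of_nat (degree p) * lead_coeff p * a ^ (degree p - 1)"
proof -
  have a0: "a \<noteq> 0" using fls_nth_neg_subdegree_nonzero[OF assms(1,3)] lead by simp
  have g0: "g \<noteq> 0" using assms(2,3) by auto
  have "\<exists>Q. laurent_eval f p - laurent_eval g p = (f - g) * Q \<and>
     fls_subdegree Q = - int (d * (degree p - 1)) \<and>
     Q $$ (- int (d * (degree p - 1))) = of_nat (degree p) * lead_coeff p * a ^ (degree p - 1)"
    using assms(6)
  proof (induction p)
    case (pCons c p)
    then have p0: "p \<noteq> 0" by (auto split: if_splits)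
    define n where "n = degree p"
    have eq: "laurent_eval f (pCons c p) - laurent_eval g (pCons c p)
        = (f - g) * laurent_eval f p + g * (laurent_eval f p - laurent_eval g p)"
      by (simp add: laurent_eval_pCons algebra_simps)
    note L = laurent_eval_leading[OF assms(1,3) p0, folded n_def, unfolded lead]
    show ?case
    proof (cases "n = 0")
      case True
      then obtain b where "p = [:b:]" by (metis degree_eq_zeroE n_def)
      then show ?thesis using eq L True p0 by (intro exI[of _ "laurent_eval f p"]) auto
    next
      case False
      then obtain Q where Q: "laurent_eval f p - laurent_eval g p = (f - g) * Q"
        "fls_subdegree Q = - int (d * (n - 1))"
        "Q $$ (- int (d * (n - 1))) = of_nat n * lead_coeff p * a ^ (n - 1)"
        using pCons.IH by (auto simp: n_def)
      have Q0: "Q \<noteq> 0" using Q(3) False a0 p0 by auto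
      define R where "R = laurent_eval f p + g * Q"
      have e: "fls_subdegree g + fls_subdegree Q = - int (d * n)"
        unfolding Q(2) assms(2) using False by (cases n) (simp_all add: algebra_simps)
      have "(g * Q) $$ (fls_subdegree g + fls_subdegree Q) = a * (of_nat n * lead_coeff p * a ^ (n - 1))"
        unfolding fls_times_base using Q(3) lead by (simp add: Q(2) assms(2))
      also have "\<dots> = of_nat n * lead_coeff p * a ^ n"
        using False by (cases n) simp_all
      finally have top: "R $$ (- int (d * n)) = of_nat (Suc n) * lead_coeff p * a ^ n"
        using L(2) unfolding R_def e by (simp add: n_def algebra_simps)
      have "fls_subdegree R = - int (d * n)"
      proof (rule fls_subdegree_eqI)
        show "R $$ (- int (d * n)) \<noteq> 0"
          unfolding top using p0 a0 by (simp del: of_nat_Suc)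
        fix k assume "k < - int (d * n)"
        then show "R $$ k = 0"
          using L(1) e by (simp add: R_def fls_times_nth_eq0)
      qed
      moreover have "laurent_eval f (pCons c p) - laurent_eval g (pCons c p) = (f - g) * R"
        unfolding eq Q(1) R_def by (simp add: algebra_simps)
      ultimately show ?thesis
        using top p0 by (intro exI[of _ R]) (simp add: n_def)
    qed
  qed simp
  then show ?thesis using that by blast
qed

lemma fls_times_vanish_below:
  fixes f g :: "complex fls"
  assumes "\<And>j. j < a \<Longrightarrow> f $$ j = 0" "\<And>j. j < b \<Longrightarrow> g $$ j = 0" "k < a + b"
  shows "(f * g) $$ k = 0"
proof (cases "f = 0 \<or> g = 0")
  case False
  then have "a \<le> fls_subdegree f" "b \<le> fls_subdegree g"
    using assms(1)[of "fls_subdegree f"] assms(2)[of "fls_subdegree g"] nth_fls_subdegree_nonzero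
    by (force simp: not_less)+
  then show ?thesis using assms(3) by (intro fls_times_nth_eq0) linarith
qed auto

lemma fls_compose_power_vanish_below:
  fixes f :: "complex fls"
  assumes "n > 0" "\<And>j. j < k \<Longrightarrow> f $$ j = 0" "i < int n * k"
  shows "fls_compose_power f n $$ i = 0"
  using assms by (auto simp: fls_nth_compose_power dvd_def)

lemma fls_compose_power_laurent_eval:
  "n > 0 \<Longrightarrow> fls_compose_power (laurent_eval f p) n = laurent_eval (fls_compose_power f n) p"
  by (intro laurent_eval_commute[where h = "\<lambda>f. fls_compose_power f n"]) simp_all

lemma fls_subdegree_compose_power:
  fixes f :: "complex fls"
  assumes "n > 0"
  shows "fls_subdegree (fls_compose_power f n) = int n * fls_subdegree f"
proof (cases "f = 0")
  case False
  show ?thesis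
  proof (rule fls_subdegree_eqI)
    show "fls_compose_power f n $$ (int n * fls_subdegree f) \<noteq> 0"
      using assms False by (simp add: fls_nth_compose_power)
    fix k assume "k < int n * fls_subdegree f"
    then show "fls_compose_power f n $$ k = 0"
      using assms by (intro fls_compose_power_vanish_below[of n "fls_subdegree f"]) auto
  qed
qed simp

lemma rotation_compose_power:
  assumes "n > 0" "s \<noteq> 0"
  shows "rotation s (fls_compose_power f n) = fls_compose_power (rotation (s ^ n) f) n"
proof (rule fls_eqI)
  fix k
  show "rotation s (fls_compose_power f n) $$ k = fls_compose_power (rotation (s ^ n) f) n $$ k"
    using assms by (auto simp: rotation_nth fls_nth_compose_power dvd_def power_int_mult)
qed

text \<open>
  Let A(f(t)) = f(t^n) and let s be a d-th root of unity. Subtracting the equation from its rotated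
  version gives (f(s t) - f(t)) Q(t) = (f(s^n u) - f(u)) at u = t^n, where Q has degree (n - 1) d.
  Choose s so that the difference f(s t) - f(t) is nonzero of the largest possible degree m. Then
  m + (n - 1) d is n times the degree of the difference for s^n, hence at most n m, so m is at least
  d. But the leading terms of f(s t) and f(t) agree, so m is less than d.
\<close>

lemma supported_on_multiples_of_semiconjugacy:
  assumes "degree A = n" "n \<ge> 2" "d > 0" "fls_subdegree f = - int d"
    and eq: "laurent_eval f A = fls_compose_power f n"
  shows "supported_on_multiples d f"
proof (rule ccontr)
  assume neg: "\<not> supported_on_multiples d f"
  define S where "S = {s. s ^ d = 1 \<and> rotation s f \<noteq> f}"
  \<comment> \<open>Exponents are negated degrees in t, so largest degree means least subdegree.\<close>
  define v where "v s = fls_subdegree (rotation s f - f)" for s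
  have "S \<noteq> {}"
    using neg supported_on_multiples_iff_rotation[OF \<open>d > 0\<close>] by (auto simp: S_def)
  moreover have "finite S"
    using finite_roots_unity[of d] \<open>d > 0\<close> by (auto simp: S_def intro: finite_subset[rotated])
  ultimately obtain s where s: "s \<in> S" and min: "\<And>r. r \<in> S \<Longrightarrow> v s \<le> v r"
    by (metis arg_min_if_finite(1) arg_min_least)
  have sd: "s ^ d = 1" and "s \<noteq> 0" and ne: "rotation s f \<noteq> f"
    using s \<open>d > 0\<close> by (auto simp: S_def power_0_left)
  define a where "a = f $$ (- int d)"
  have a0: "a \<noteq> 0" using fls_nth_neg_subdegree_nonzero[OF assms(4,3)] by (simp add: a_def)
  have lead: "rotation s f $$ (- int d) = a"
    using root_of_unity_power_int_dvd[OF sd, of "- int d"] by (simp add: rotation_nth \<open>s \<noteq> 0\<close> a_def)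
  have sub: "fls_subdegree (rotation s f) = - int d"
    using lead a0 assms by (intro fls_subdegree_eqI) (auto simp: rotation_nth \<open>s \<noteq> 0\<close>)
  have "degree A > 0" using assms by simp
  from laurent_eval_difference_quotient[OF sub assms(4,3) lead a_def[symmetric] this]
  obtain Q where Q: "laurent_eval (rotation s f) A - laurent_eval f A = (rotation s f - f) * Q"
    "fls_subdegree Q = - int (d * (n - 1))"
    "Q $$ (- int (d * (n - 1))) = of_nat n * lead_coeff A * a ^ (n - 1)"
    using assms(1) by auto
  have Q0: "Q \<noteq> 0" using Q(3) assms a0 by auto
  have "(rotation s f - f) * Q = rotation s (laurent_eval f A) - laurent_eval f A"
    using Q(1) by (simp add: rotation_laurent_eval \<open>s \<noteq> 0\<close>)
  also have "\<dots> = fls_compose_power (rotation (s ^ n) f - f) n"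
    using assms by (simp add: eq rotation_compose_power \<open>s \<noteq> 0\<close>)
  finally have main: "(rotation s f - f) * Q = fls_compose_power (rotation (s ^ n) f - f) n" .
  have "rotation (s ^ n) f \<noteq> f"
    using main ne Q0 by auto
  moreover have "(s ^ n) ^ d = 1" by (metis sd power_commutes power_mult power_one mult.commute)
  ultimately have le: "v s \<le> v (s ^ n)" by (intro min) (simp add: S_def)
  have "v s + fls_subdegree Q = int n * v (s ^ n)"
    using arg_cong[OF main, of fls_subdegree] assms(2) ne Q0
    by (simp add: fls_subdegree_compose_power v_def del: fls_compose_power_diff)
  moreover have "int n * v s \<le> int n * v (s ^ n)" using le by (simp add: mult_left_mono)
  ultimately have "int n * v s \<le> v s - int (n - 1) * int d" by (simp add: Q(2) mult.commute)
  then have "int (n - 1) * v s \<le> int (n - 1) * (- int d)"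
    using assms(2) by (simp add: of_nat_diff algebra_simps)
  then have "v s \<le> - int d"
    using assms(2) by (simp only: mult_le_cancel_left)
  moreover have "(rotation s f - f) $$ k = 0" if "k \<le> - int d" for k
    using that lead sub assms(4) by (cases "k = - int d") (auto simp: a_def)
  then have "v s > - int d"
    using ne nth_fls_subdegree_nonzero[of "rotation s f - f"] unfolding v_def
    by (meson eq_iff_diff_eq_0 not_less)
  ultimately show False by simp
qed

section \<open>The formal Boettcher coordinate\<close>

text \<open>
  Near infinity a polynomial of degree n at least 2 is conjugate to the n-th power map; here the
  conjugacy is needed only as a formal series, and is found as the fixed point of a Newton-like
  iteration. The derivative of B at a series with leading term c t has leading term n t^(n-1),
  because c is chosen with b c^(n-1) = 1 for the leading coefficient b of B. Dividing the defect by n t^(n-1) therefore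
  corrects one more coefficient at each step, the term g(t^n) being too sparse to interfere.
\<close>

lemma boettcher_coordinate_exists:
  fixes B :: "complex poly"
  assumes "degree B = n" "n \<ge> 2"
  obtains \<gamma> where "fls_subdegree \<gamma> = - 1" "laurent_eval \<gamma> B = fls_compose_power \<gamma> n"
proof -
  have b0: "lead_coeff B \<noteq> 0" using assms by auto
  obtain c where c: "c ^ (n - 1) = 1 / lead_coeff B"
    using nth_root_exists[of "n - 1" "1 / lead_coeff B"] assms by auto
  have c0: "c \<noteq> 0"
    using c b0 assms by (auto simp: power_0_left split: if_splits)
  have bc: "lead_coeff B * c ^ (n - 1) = 1" using c b0 by simp
  have bcn: "lead_coeff B * c ^ n = c"
    using bc assms(2) by (cases n) (simp_all add: algebra_simps)
  define T where "T g = g - fls_const (1 / of_nat n) * (fls_X ^ (n - 1) *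
     (laurent_eval g B - fls_compose_power g n))" for g
  \<comment> \<open>Admissible series are those with leading term c t, where c solves the top-degree equation.\<close>
  define adm where "adm g \<longleftrightarrow> g $$ (-1) = c \<and> (\<forall>j < -1. g $$ j = 0)" for g
  have sub: "fls_subdegree g = - int 1" "g $$ (- int 1) = c" if "adm g" for g
    using that c0 by (auto simp: adm_def intro!: fls_subdegree_eqI)
  have n1: "int (n - 1) = int n - 1" using assms by simp
  have shift: "(fls_X ^ (n - Suc 0) * h) $$ j = h $$ (j - int n + 1)" for h :: "complex fls" and j
    by (simp add: fls_X_power_times_conv_shift n1[simplified] algebra_simps)
  have degB: "degree B > 0" using assms by simp
  have T_adm: "adm (T g)" if "adm g" for g
  proof -
    have B0: "B \<noteq> 0" using b0 by auto
    note L = laurent_eval_leading[OF sub(1)[OF that] zero_less_one B0]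
    have s: "fls_subdegree (laurent_eval g B) = - int n" using L(1) assms by simp
    have l: "laurent_eval g B $$ (- int n) = c"
      using L(2) sub(2)[OF that] bcn assms by simp
    have cs: "fls_subdegree (fls_compose_power g n) = - int n"
      using assms sub[OF that] by (simp add: fls_subdegree_compose_power)
    have cl: "fls_compose_power g n $$ (- int n) = c"
      using assms that by (simp add: fls_nth_compose_power adm_def dvd_neg_div)
    have "(laurent_eval g B - fls_compose_power g n) $$ k = 0" if "k \<le> - int n" for k
      using that s l cs cl by (cases "k = - int n") auto
    then show ?thesis
      using that unfolding adm_def T_def by (simp add: shift)
  qed
  have T_contract: "T g $$ j = T h $$ j"
    if gh: "adm g" "adm h" and eq: "\<And>j. j < k \<Longrightarrow> g $$ j = h $$ j" and k: "k \<ge> 0" "j \<le> k"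
    for g h k j
  proof -
    obtain Q where Q: "laurent_eval g B - laurent_eval h B = (g - h) * Q"
      "fls_subdegree Q = - int (n - 1)" "Q $$ (- int (n - 1)) = of_nat n"
      using laurent_eval_difference_quotient[OF sub(1)[OF gh(1)] sub(1)[OF gh(2)] zero_less_one
          sub(2)[OF gh(1)] sub(2)[OF gh(2)] degB] bc assms(1)
      by (metis mult.assoc mult.right_neutral mult_1)
    \<comment> \<open>Q has leading term n t^(n-1), so U has no constant term: each step gains one coefficient.\<close>
    define U where "U = 1 - fls_const (1 / of_nat n) * (fls_X ^ (n - 1) * Q)"
    have U: "U $$ i = 0" if "i < 1" for i
    proof (cases "i = 0")
      case True
      then show ?thesis using Q(3) assms by (simp add: U_def shift n1)
    next
      case False
      then have "i - int n + 1 < fls_subdegree Q" unfolding Q(2) n1 using that by simp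
      then show ?thesis using False by (simp add: U_def shift)
    qed
    have "T g - T h = (g - h) * U + fls_const (1 / of_nat n) * (fls_X ^ (n - 1) *
        fls_compose_power (g - h) n)"
    proof -
      have "T g - T h = (g - h) - fls_const (1 / of_nat n) * (fls_X ^ (n - 1) *
         ((laurent_eval g B - laurent_eval h B) - fls_compose_power (g - h) n))"
        by (simp add: T_def algebra_simps)
      then show ?thesis unfolding Q(1) U_def by (simp add: algebra_simps)
    qed
    moreover have "((g - h) * U) $$ j = 0"
      using eq k U by (intro fls_times_vanish_below[of k _ 1]) auto
    moreover have "fls_compose_power (g - h) n $$ (j - int n + 1) = 0"
    proof (rule fls_compose_power_vanish_below[of n k])
      have "k \<le> int n * k" using assms k(1) by (simp add: mult_le_cancel_right1)
      then show "j - int n + 1 < int n * k" using k assms by linarith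
    qed (use assms eq in auto)
    ultimately have "(T g - T h) $$ j = 0" by (simp add: shift)
    then show ?thesis by simp
  qed
  define G where "G m = (T ^^ m) (fls_const c * fls_X_inv)" for m
  have G_Suc: "G (Suc m) = T (G m)" for m by (simp add: G_def)
  have G_adm: "adm (G m)" for m
  proof (induction m)
    case 0
    then show ?case by (auto simp: G_def adm_def)
  qed (simp add: G_Suc T_adm)
  have G_step: "G (Suc m) $$ j = G m $$ j" if "j < int m" for m j
    using that
  proof (induction m arbitrary: j)
    case 0
    then have "j \<le> -1" by simp
    then show ?case using G_adm[of 0] G_adm[of 1] by (cases "j = -1") (auto simp: adm_def)
  next
    case (Suc m)
    show ?case
      unfolding G_Suc[of "Suc m"] G_Suc[of m]
      by (rule T_contract[where k = "int m"]) (use Suc G_adm T_adm in \<open>auto simp flip: G_Suc\<close>)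
  qed
  have G_stable: "G l $$ j = G m $$ j" if "j < int m" "m \<le> l" for l m j
    using that(2,1)
  proof (induction l rule: dec_induct)
    case (step l)
    then show ?case using G_step[of j l] by simp
  qed simp
  \<comment> \<open>The i-th iterate is correct below exponent i; the diagonal coefficients form the limit.\<close>
  define \<gamma> where "\<gamma> = fls_shift 1 (fps_to_fls (Abs_fps (\<lambda>i. G i $$ (int i - 1))))"
  have \<gamma>_G: "\<gamma> $$ j = G m $$ j" if "j < int m" for j m
  proof (cases "j < -1")
    case True
    then show ?thesis using G_adm[of m] by (simp add: \<gamma>_def adm_def)
  next
    case False
    then have "\<gamma> $$ j = G (nat (j + 1)) $$ j" by (simp add: \<gamma>_def)
    also have "\<dots> = G m $$ j" using that False by (intro G_stable[symmetric]) auto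
    finally show ?thesis .
  qed
  have \<gamma>_adm: "adm \<gamma>"
    using G_adm[of 0] \<gamma>_G[of _ 0] by (auto simp: adm_def)
  have "T \<gamma> = \<gamma>"
  proof (rule fls_eqI)
    fix j
    define m where "m = nat j"
    have "T \<gamma> $$ j = T (G m) $$ j"
      by (rule T_contract[where k = "int m"]) (use \<gamma>_adm G_adm \<gamma>_G in \<open>auto simp: m_def\<close>)
    also have "\<dots> = \<gamma> $$ j"
      unfolding G_Suc[symmetric] by (rule \<gamma>_G[symmetric]) (simp add: m_def)
    finally show "T \<gamma> $$ j = \<gamma> $$ j" .
  qed
  then have "laurent_eval \<gamma> B = fls_compose_power \<gamma> n"
    using assms by (simp add: T_def)
  then show ?thesis using that sub[OF \<gamma>_adm] by simp
qed

section \<open>Semiconjugacies as polynomials with restricted support\<close>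

lemma pcompose_power: "pcompose (p ^ k) q = pcompose p q ^ k"
  by (induction k) (simp_all add: pcompose_mult pcompose_1)

text \<open>
  Division by X, peeling off leading terms: the support forces the degree of P to be a multiple
  of d, so a multiple of a power of X cancels the leading term of P, and the support condition
  survives the subtraction.
\<close>

lemma decomposition_of_supported_on_multiples:
  assumes \<gamma>: "fls_subdegree \<gamma> = - 1"
    and "degree X = d" "d > 0" "supported_on_multiples d (laurent_eval \<gamma> X)"
    and "supported_on_multiples d (laurent_eval \<gamma> P)"
  shows "\<exists>Q. P = Q \<circ>\<^sub>p X"
  using assms(5)
proof (induction "degree P" arbitrary: P rule: less_induct)
  case less
  have \<gamma>1: "fls_subdegree \<gamma> = - int 1" using \<gamma> by simp
  have \<gamma>0: "\<gamma> $$ (- int 1) \<noteq> 0" by (rule fls_nth_neg_subdegree_nonzero[OF \<gamma>1]) simp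
  show ?case
  proof (cases "degree P = 0")
    case True
    then obtain a where "P = [:a:]" by (rule degree_eq_zeroE)
    then show ?thesis by (intro exI[of _ "[:a:]"]) simp
  next
    case False
    then have "P \<noteq> 0" by auto
    then have "laurent_eval \<gamma> P $$ (- int (degree P)) \<noteq> 0"
      using laurent_eval_leading(2)[OF \<gamma>1, of P] \<gamma>0 by auto
    then have "d dvd degree P" using less.prems by (auto simp: supported_on_multiples_def)
    then obtain k where k: "degree P = d * k" by auto
    have X0: "X \<noteq> 0" using assms by auto
    define M where "M = smult (lead_coeff P / lead_coeff X ^ k) ([:0, 1:] ^ k)"
    have MX: "M \<circ>\<^sub>p X = smult (lead_coeff P / lead_coeff X ^ k) (X ^ k)"
      by (simp add: M_def pcompose_smult pcompose_power pcompose_pCons)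
    have degX: "degree (X ^ k) = degree P" using assms(2) k X0 by (simp add: degree_power_eq)
    define R where "R = P - M \<circ>\<^sub>p X"
    have "coeff (X ^ k) (degree P) = lead_coeff X ^ k"
      using lead_coeff_power[of X k] degX by simp
    then have "coeff R (degree P) = 0" using X0 by (simp add: R_def MX)
    moreover have "degree R \<le> degree P"
      unfolding R_def MX using degX by (intro degree_diff_le) (auto intro: order.trans[OF degree_smult_le])
    ultimately have "degree R < degree P"
      using False by (metis le_neq_implies_less leading_coeff_0_iff degree_0)
    moreover have "supported_on_multiples d (laurent_eval \<gamma> R)"
      unfolding R_def laurent_eval_diff laurent_eval_pcompose
      by (intro supported_on_multiples_diff supported_on_multiples_laurent_eval less.prems assms)
    ultimately obtain Q where "R = Q \<circ>\<^sub>p X" using less.hyps by blast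
    then have "P = (Q + M) \<circ>\<^sub>p X" by (simp add: R_def pcompose_add algebra_simps)
    then show ?thesis by blast
  qed
qed

text \<open>
  This turns the functional equation into a linear condition on X. One direction is the rigidity
  of solutions; for the other, X(B(\<gamma>(t))) = X(\<gamma>(t^n)) is again a series in t^d, so
  the composition of X with B is a polynomial in X.
\<close>

lemma semiconjugacy_iff_supported_on_multiples:
  assumes "degree B = n" "n \<ge> 2" and \<gamma>: "fls_subdegree \<gamma> = - 1"
    and boettcher: "laurent_eval \<gamma> B = fls_compose_power \<gamma> n"
    and "degree X = d" "d > 0"
  shows "(\<exists>A. A \<circ>\<^sub>p X = X \<circ>\<^sub>p B) \<longleftrightarrow> supported_on_multiples d (laurent_eval \<gamma> X)"
proof -
  have XB: "laurent_eval \<gamma> (X \<circ>\<^sub>p B) = fls_compose_power (laurent_eval \<gamma> X) n"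
    using assms(2) by (simp add: laurent_eval_pcompose boettcher fls_compose_power_laurent_eval)
  show ?thesis
  proof
    assume "\<exists>A. A \<circ>\<^sub>p X = X \<circ>\<^sub>p B"
    then obtain A where A: "A \<circ>\<^sub>p X = X \<circ>\<^sub>p B" by blast
    then have "degree A * d = d * n" using assms by (metis degree_pcompose)
    then have "degree A = n" using assms(6) by simp
    moreover have "laurent_eval (laurent_eval \<gamma> X) A = fls_compose_power (laurent_eval \<gamma> X) n"
      using A XB by (simp flip: laurent_eval_pcompose)
    moreover have "fls_subdegree (laurent_eval \<gamma> X) = - int d"
      using laurent_eval_leading(1)[of \<gamma> 1 X] assms by force
    ultimately show "supported_on_multiples d (laurent_eval \<gamma> X)"
      using supported_on_multiples_of_semiconjugacy assms(2,6) by blast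
  next
    assume S: "supported_on_multiples d (laurent_eval \<gamma> X)"
    then have "supported_on_multiples d (laurent_eval \<gamma> (X \<circ>\<^sub>p B))"
      unfolding XB using assms(2) by (intro supported_on_multiples_compose_power) auto
    from decomposition_of_supported_on_multiples[OF \<gamma> assms(5,6) S this]
    show "\<exists>A. A \<circ>\<^sub>p X = X \<circ>\<^sub>p B" by metis
  qed
qed

section \<open>The conjugates of the generic point in a fibre\<close>

lemma poly_eq_prod_of_distinct_roots:
  fixes p :: "'a::idom poly"
  assumes "finite S" "card S = degree p" "\<And>x. x \<in> S \<Longrightarrow> poly p x = 0"
  shows "p = smult (lead_coeff p) (\<Prod>x\<in>S. [:- x, 1:])"
proof (rule poly_eqI_degree_lead_coeff[where n = "degree p" and A = S])
  have deg: "degree (\<Prod>x\<in>S. [:- x, 1:]) = degree p"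
    using assms by (simp add: degree_prod_sum_eq)
  have "lead_coeff (\<Prod>x\<in>S. [:- x, 1:]) = 1"
    by (simp add: lead_coeff_prod)
  then show "coeff p (degree p) = coeff (smult (lead_coeff p) (\<Prod>x\<in>S. [:- x, 1:])) (degree p)"
    using deg by simp
  show "degree (smult (lead_coeff p) (\<Prod>x\<in>S. [:- x, 1:])) \<le> degree p"
    using degree_smult_le[of "lead_coeff p" "\<Prod>x\<in>S. [:- x, 1:]"] deg by simp
  show "poly p z = poly (smult (lead_coeff p) (\<Prod>x\<in>S. [:- x, 1:])) z" if "z \<in> S" for z
    using assms that by (auto simp: poly_prod prod_zero_iff)
qed (use assms in auto)

lemma rotation_inj:
  assumes \<gamma>: "fls_subdegree \<gamma> = - 1" and "s \<noteq> 0" "r \<noteq> 0" "rotation s \<gamma> = rotation r \<gamma>"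
  shows "s = r"
proof -
  have "\<gamma> $$ (-1) \<noteq> 0" using \<gamma> fls_nth_neg_subdegree_nonzero[of \<gamma> 1] by simp
  moreover have "\<gamma> $$ (-1) * s powi (-1) = \<gamma> $$ (-1) * r powi (-1)"
    using assms(2-4) by (metis rotation_nth)
  ultimately show ?thesis by (simp add: power_int_minus)
qed

lemma root_of_unity_nonzero: "d > 0 \<Longrightarrow> s ^ d = 1 \<Longrightarrow> s \<noteq> (0::complex)"
  by (auto simp: power_0_left)

lemma rotation_inj_on:
  "fls_subdegree \<gamma> = - 1 \<Longrightarrow> d > 0 \<Longrightarrow> inj_on (\<lambda>s. rotation s \<gamma>) {s. s ^ d = 1}"
  by (intro inj_onI, elim CollectE) (rule rotation_inj; simp add: root_of_unity_nonzero[of d])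

text \<open>
  X(y) - X(z) as a polynomial in y, with the series \<gamma> in place of z.
\<close>

definition fiber_poly :: "complex fls \<Rightarrow> complex poly \<Rightarrow> complex fls poly" where
  "fiber_poly \<gamma> X = map_poly fls_const X - [:laurent_eval \<gamma> X:]"

lemma poly_fiber_poly: "poly (fiber_poly \<gamma> X) y = laurent_eval y X - laurent_eval \<gamma> X"
  by (simp add: fiber_poly_def laurent_eval_def)

lemma fiber_poly_degree:
  assumes "degree X > 0"
  shows "degree (fiber_poly \<gamma> X) = degree X" "lead_coeff (fiber_poly \<gamma> X) = fls_const (lead_coeff X)"
proof -
  have 1: "degree (map_poly fls_const X) = degree X" by (intro degree_map_poly) simp
  show 2: "degree (fiber_poly \<gamma> X) = degree X"
    unfolding fiber_poly_def diff_conv_add_uminus using assms 1 by (subst degree_add_eq_left) auto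
  show "lead_coeff (fiber_poly \<gamma> X) = fls_const (lead_coeff X)"
    unfolding 2 using assms by (simp add: fiber_poly_def coeff_map_poly coeff_pCons split: nat.splits)
qed

lemma rotation_root:
  assumes "d > 0" "supported_on_multiples d (laurent_eval \<gamma> X)" "s ^ d = 1"
  shows "poly (fiber_poly \<gamma> X) (rotation s \<gamma>) = 0"
  using assms root_of_unity_nonzero[OF assms(1,3)]
  by (simp add: poly_fiber_poly supported_on_multiples_iff_rotation flip: rotation_laurent_eval)

text \<open>
  Since X(\<gamma>(t)) depends only on t^d, the d series \<gamma>(s t) with s^d = 1 all solve
  X(y) = X(\<gamma>(t)); they are distinct, so they are all the solutions.
\<close>

lemma fiber_poly_factorization:
  assumes "fls_subdegree \<gamma> = - 1"
    and "degree X = d" "d > 0" "supported_on_multiples d (laurent_eval \<gamma> X)"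
  shows "fiber_poly \<gamma> X = smult (fls_const (lead_coeff X)) (\<Prod>s | s ^ d = 1. [:- rotation s \<gamma>, 1:])"
proof -
  let ?S = "(\<lambda>s. rotation s \<gamma>) ` {s. s ^ d = 1}"
  have "card ?S = d" using rotation_inj_on[OF assms(1,3)] assms(3)
    by (simp add: card_image card_roots_unity_eq)
  then have "fiber_poly \<gamma> X = smult (lead_coeff (fiber_poly \<gamma> X)) (\<Prod>x\<in>?S. [:- x, 1:])"
    using assms rotation_root[OF assms(3,4)] finite_roots_unity[of d, where ?'a = complex]
    by (intro poly_eq_prod_of_distinct_roots) (auto simp: fiber_poly_degree)
  moreover have "lead_coeff (fiber_poly \<gamma> X) = fls_const (lead_coeff X)"
    using assms by (intro fiber_poly_degree) simp
  ultimately show ?thesis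
    using rotation_inj_on[OF assms(1,3)] by (simp only: prod.reindex o_def)
qed

lemma poly_fiber_poly_eq_0_iff:
  assumes "fls_subdegree \<gamma> = - 1"
    and "degree X = d" "d > 0" "supported_on_multiples d (laurent_eval \<gamma> X)"
  shows "poly (fiber_poly \<gamma> X) y = 0 \<longleftrightarrow> (\<exists>s. s ^ d = 1 \<and> y = rotation s \<gamma>)"
proof
  assume "poly (fiber_poly \<gamma> X) y = 0"
  moreover have "lead_coeff X \<noteq> 0" using assms by auto
  ultimately show "\<exists>s. s ^ d = 1 \<and> y = rotation s \<gamma>"
    using assms finite_roots_unity[of d, where ?'a = complex]
    unfolding fiber_poly_factorization[OF assms] by (auto simp: poly_prod prod_zero_iff)
qed (use rotation_root[OF assms(3,4)] in auto)

section \<open>The common right factor of greatest degree\<close>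

text \<open>
  Gauss's lemma in the form that clears a scalar denominator.
\<close>

lemma dvd_of_primitive_dvd_smult:
  fixes m F q :: "'a::{factorial_ring_gcd, semiring_gcd_mult_normalize} poly"
  assumes "content m = 1" "smult a F = m * q" "a \<noteq> 0"
  shows "m dvd F"
proof -
  have "content q = content (m * q)" by (simp add: content_mult assms)
  also have "\<dots> = normalize a * content F" unfolding assms(2)[symmetric] by simp
  finally have "[:a:] dvd q" by (simp add: const_poly_dvd_iff_dvd_content)
  then obtain q' where "q = smult a q'" by (auto simp: dvd_def)
  then have "smult a F = smult a (m * q')" using assms(2) by simp
  then have "smult a (F - m * q') = 0" by (simp add: smult_diff_right)
  then have "F = m * q'" using assms(3) by simp
  then show ?thesis by simp
qed

text \<open>
  Over a unique factorization domain the greatest common divisor is a combination of F and G only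
  up to a scalar c. The divisor m is the primitive part of a member of least degree of the ideal
  generated by F and G; pseudo-division shows that this member divides scalar multiples of F and G.
\<close>

lemma common_divisor_bezout:
  fixes F G :: "'a::{factorial_ring_gcd, semiring_gcd_mult_normalize} poly"
  assumes "F \<noteq> 0"
  obtains m c a b where "m dvd F" "m dvd G" "c \<noteq> 0" "smult c m = a * F + b * G"
proof -
  define J where "J = {h. h \<noteq> 0 \<and> (\<exists>a b. h = a * F + b * G)}"
  have "F = 1 * F + 0 * G" by simp
  then have "F \<in> J" using assms unfolding J_def by blast
  then obtain m0 where m0: "m0 \<in> J" and min: "\<And>h. h \<in> J \<Longrightarrow> degree m0 \<le> degree h"
    using ex_has_least_nat[of "\<lambda>h. h \<in> J" F degree] by blast
  obtain a b where ab: "m0 = a * F + b * G" and "m0 \<noteq> 0" using m0 by (auto simp: J_def)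
  define m where "m = primitive_part m0"
  have m: "smult (content m0) m = m0" "content m = 1"
    using \<open>m0 \<noteq> 0\<close> by (simp_all add: m_def)
  have dvd: "m dvd H" if H: "\<exists>a b. H = a * F + b * G" for H
  proof -
    obtain u v where uv: "H = u * F + v * G" using H by blast
    obtain e q where e: "e \<noteq> 0" "smult e H = m0 * q + pseudo_mod H m0"
      and r: "pseudo_mod H m0 = 0 \<or> degree (pseudo_mod H m0) < degree m0"
      using pseudo_mod[OF \<open>m0 \<noteq> 0\<close>, of H] by auto
    have "pseudo_mod H m0 = (smult e u - q * a) * F + (smult e v - q * b) * G"
      using e(2) unfolding ab uv by (simp add: algebra_simps smult_add_right)
    then have "pseudo_mod H m0 \<noteq> 0 \<Longrightarrow> pseudo_mod H m0 \<in> J" by (auto simp: J_def)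
    then have "pseudo_mod H m0 = 0" using r min by fastforce
    then have "smult e H = smult (content m0) m * q" using e(2) by (simp only: m(1) add_0_right)
    then have "smult e H = m * smult (content m0) q" by simp
    then show "m dvd H" using dvd_of_primitive_dvd_smult m(2) e(1) by blast
  qed
  have "F = 1 * F + 0 * G" "G = 0 * F + 1 * G" by simp_all
  then have "m dvd F" "m dvd G" using dvd by blast+
  then show ?thesis using that[of m "content m0" a b] m ab \<open>m0 \<noteq> 0\<close> by simp
qed

lemma fls_subdegree_prod:
  fixes f :: "'i \<Rightarrow> complex fls"
  assumes "\<And>i. i \<in> I \<Longrightarrow> f i \<noteq> 0"
  shows "fls_subdegree (\<Prod>i\<in>I. f i) = (\<Sum>i\<in>I. fls_subdegree (f i))"
  using assms
proof (induction I rule: infinite_finite_induct)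
  case (insert i I)
  then have "(\<Prod>i\<in>I. f i) \<noteq> 0" by (simp add: prod_zero_iff)
  then show ?case using insert by simp
qed simp_all

text \<open>
  Up to a constant, this product is W(\<gamma>(t)) for the common right factor W of degree g:
  rotating t by a g-th root of unity permutes the factors.
\<close>

lemma norm_of_rotations:
  assumes \<gamma>: "fls_subdegree \<gamma> = - 1" and "g > 0"
  defines "N \<equiv> \<Prod>s | s ^ g = 1. - rotation s \<gamma>"
  shows "supported_on_multiples g N" "fls_subdegree N = - int g"
proof -
  have sub: "fls_subdegree (rotation s \<gamma>) = - 1" if "s \<noteq> 0" for s
    using \<gamma> that fls_nth_neg_subdegree_nonzero[of \<gamma> 1]
    by (intro fls_subdegree_eqI) (auto simp: rotation_nth)
  have "- rotation s \<gamma> \<noteq> 0 \<and> fls_subdegree (- rotation s \<gamma>) = - 1" if "s ^ g = 1" for s :: complex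
    using sub[OF root_of_unity_nonzero[OF assms(2) that]] by auto
  then show "fls_subdegree N = - int g"
    unfolding N_def using assms(2) by (subst fls_subdegree_prod) (auto simp: card_roots_unity_eq)
  show "supported_on_multiples g N"
    unfolding supported_on_multiples_iff_rotation[OF assms(2)]
  proof (intro allI impI)
    fix r :: complex assume r: "r ^ g = 1"
    note nz = root_of_unity_nonzero[OF assms(2)]
    have "rotation r N = (\<Prod>s | s ^ g = 1. rotation r (- rotation s \<gamma>))"
      unfolding N_def by (rule rotation_prod) (use nz r in auto)
    also have "\<dots> = (\<Prod>s | s ^ g = 1. - rotation (r * s) \<gamma>)"
    proof (rule prod.cong)
      fix s :: complex assume "s \<in> {s. s ^ g = 1}"
      then have "r \<noteq> 0" "s \<noteq> 0" using r nz by auto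
      then show "rotation r (- rotation s \<gamma>) = - rotation (r * s) \<gamma>"
        by (intro fls_eqI) (simp add: rotation_nth power_int_mult_distrib)
    qed simp
    also have "\<dots> = N"
      unfolding N_def using nz r
      by (intro prod.reindex_bij_witness[of _ "\<lambda>s. s / r" "\<lambda>s. r * s"])
        (auto simp: power_mult_distrib power_divide)
    finally show "rotation r N = N" .
  qed
qed

text \<open>
  Let m be the greatest common divisor of X1(y) - X1(z) and X2(y) - X2(z) in the polynomial ring in
  y over the polynomials in z. At z = \<gamma>(t) its roots are the common roots \<gamma>(s t) of the
  two polynomials, that is, those with s^g = 1 for g = gcd d1 d2, and all of them are simple. As m
  divides polynomials in y with constant leading coefficient, its own leading coefficient is a
  constant. Hence the value of m at y = 0 is a polynomial in z which, at z = \<gamma>(t), is a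
  constant times the product of the -\<gamma>(s t). This is the required W.
\<close>

lemma gcd_degree_polynomial:
  assumes \<gamma>: "fls_subdegree \<gamma> = - 1"
    and X1: "degree X1 = d1" "d1 > 0" "supported_on_multiples d1 (laurent_eval \<gamma> X1)"
    and X2: "degree X2 = d2" "d2 > 0" "supported_on_multiples d2 (laurent_eval \<gamma> X2)"
  shows "\<exists>W. degree W = gcd d1 d2 \<and> supported_on_multiples (gcd d1 d2) (laurent_eval \<gamma> W)"
proof -
  define g where "g = gcd d1 d2"
  have "g > 0" using X1 by (simp add: g_def)
  let ?h = "map_poly (laurent_eval \<gamma>)"
  have \<gamma>1: "fls_subdegree \<gamma> = - int 1" using \<gamma> by simp
  note inj = laurent_eval_eq_0_iff[OF \<gamma>1 zero_less_one]
  have h_add: "?h (p + q) = ?h p + ?h q" for p q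
    by (simp add: map_poly_add_hom laurent_eval_add)
  have h_mult: "?h (p * q) = ?h p * ?h q" for p q
    by (simp add: map_poly_mult_hom laurent_eval_add laurent_eval_mult)
  define F where "F X = map_poly (\<lambda>c. [:c:]) X - [:X:]" for X :: "complex poly"
  \<comment> \<open>Substituting z = \<gamma>(t) turns X(y) - X(z) into the fibre polynomial.\<close>
  have h_F: "?h (F X) = fiber_poly \<gamma> X" for X
    by (intro poly_eqI) (simp add: F_def fiber_poly_def coeff_map_poly laurent_eval_diff coeff_pCons
        split: nat.splits)
  have lead_F: "lead_coeff (F X) = [:lead_coeff X:]" if "degree X > 0" for X
  proof -
    have "degree (?h (F X)) = degree (F X)" by (intro degree_map_poly) (simp add: inj)
    then have "degree (F X) = degree X" using fiber_poly_degree(1)[OF that] by (simp add: h_F)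
    then show ?thesis using that by (simp add: F_def coeff_map_poly coeff_pCons split: nat.splits)
  qed
  have "F X1 \<noteq> 0" using lead_F[of X1] X1 by fastforce
  then obtain m c a b where m: "m dvd F X1" "m dvd F X2" and c: "c \<noteq> 0"
    and bez: "smult c m = a * F X1 + b * F X2"
    using common_divisor_bezout[of "F X1" "F X2"] by metis
  define M where "M = ?h m"
  have degM: "degree M = degree m" unfolding M_def by (intro degree_map_poly) (simp add: inj)
  obtain q where q: "F X1 = m * q" using m(1) by auto
  have q0: "m \<noteq> 0" "q \<noteq> 0" using q \<open>F X1 \<noteq> 0\<close> by auto
  have "lead_coeff m * lead_coeff q = [:lead_coeff X1:]"
    using lead_F[of X1] X1 q by (simp add: lead_coeff_mult)
  then have "degree (lead_coeff m * lead_coeff q) = 0" by simp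
  \<comment> \<open>The leading coefficient of m is a polynomial in z that divides a nonzero constant.\<close>
  then have "degree (lead_coeff m) = 0" using q0 by (simp add: degree_mult_eq)
  then obtain u where u: "lead_coeff m = [:u:]" by (rule degree_eq_zeroE)
  then have u0: "u \<noteq> 0" using q0 by auto
  have fac1: "fiber_poly \<gamma> X1 = M * ?h q" using q h_mult h_F by (metis M_def)
  have M0: "M \<noteq> 0" "?h q \<noteq> 0"
    using fac1 fiber_poly_degree(1)[of X1 \<gamma>] X1 by auto
  let ?R = "\<lambda>d. (\<lambda>s. rotation s \<gamma>) ` {s. s ^ d = 1}"
  have card_R: "card (?R d) = d" if "d > 0" for d
    using rotation_inj_on[OF \<gamma> that] that by (simp add: card_image card_roots_unity_eq)
  have roots: "{y. poly M y = 0} = ?R g"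
  proof (intro equalityI subsetI)
    fix y assume "y \<in> {y. poly M y = 0}"
    moreover have "M dvd fiber_poly \<gamma> X1" "M dvd fiber_poly \<gamma> X2"
      using m h_mult h_F by (metis M_def dvd_def)+
    ultimately have "poly (fiber_poly \<gamma> X1) y = 0" "poly (fiber_poly \<gamma> X2) y = 0"
      by (auto simp: dvd_def)
    then obtain s r where s: "s ^ d1 = 1" "y = rotation s \<gamma>" and r: "r ^ d2 = 1" "y = rotation r \<gamma>"
      using poly_fiber_poly_eq_0_iff[OF \<gamma> X1] poly_fiber_poly_eq_0_iff[OF \<gamma> X2] by blast
    have nz: "s \<noteq> 0" "r \<noteq> 0" using s r X1 X2 by (auto simp: power_0_left)
    then have "s = r" using rotation_inj[OF \<gamma>] s r by metis
    moreover obtain i j where ij: "d1 * i = d2 * j + g"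
      using bezout_nat[of d1 d2] X1 by (auto simp: g_def)
    have "s ^ (d1 * i) = 1" using s by (simp add: power_mult)
    moreover have "r ^ (d2 * j + g) = r ^ g" using r by (simp add: power_mult power_add)
    ultimately have "s ^ g = 1" unfolding ij by simp
    then show "y \<in> ?R g" using s by auto
  next
    fix y assume "y \<in> ?R g"
    then obtain s where s: "s ^ g = 1" "y = rotation s \<gamma>" by auto
    have "s ^ d1 = 1" "s ^ d2 = 1"
      using s(1) by (metis g_def gcd_dvd1 gcd_dvd2 dvd_def power_mult power_one)+
    then have "poly (fiber_poly \<gamma> X1) y = 0" "poly (fiber_poly \<gamma> X2) y = 0"
      using rotation_root[OF X1(2,3)] rotation_root[OF X2(2,3)] s(2) by auto
    then have "poly (?h (smult c m)) y = 0"
      unfolding bez by (simp add: h_add h_mult h_F)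
    moreover have "?h (smult c m) = smult (laurent_eval \<gamma> c) M"
      unfolding M_def by (intro map_poly_smult) (simp_all add: laurent_eval_mult)
    ultimately show "y \<in> {y. poly M y = 0}" using c by (simp add: inj)
  qed
  \<comment> \<open>A factor of a polynomial with as many distinct roots as its degree has the same property.\<close>
  have "d1 \<le> card ({y. poly M y = 0} \<union> {y. poly (?h q) y = 0})"
  proof -
    have "?R d1 \<subseteq> {y. poly (fiber_poly \<gamma> X1) y = 0}" using rotation_root[OF X1(2,3)] by auto
    also have "\<dots> = {y. poly M y = 0} \<union> {y. poly (?h q) y = 0}" by (auto simp: fac1)
    finally show ?thesis
      using card_R[OF X1(2)] M0 card_mono[of "{y. poly M y = 0} \<union> {y. poly (?h q) y = 0}" "?R d1"]
      by (simp add: poly_roots_finite)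
  qed
  also have "\<dots> \<le> card {y. poly M y = 0} + card {y. poly (?h q) y = 0}" by (rule card_Un_le)
  finally have "d1 \<le> card (?R g) + degree (?h q)"
    using card_poly_roots_bound[OF M0(2)] by (simp add: roots)
  moreover have "d1 = degree M + degree (?h q)"
    using fiber_poly_degree(1)[of X1 \<gamma>] X1 M0 by (simp add: fac1 degree_mult_eq)
  moreover have "card (?R g) \<le> degree M" using card_poly_roots_bound[OF M0(1)] roots by simp
  ultimately have cardM: "card (?R g) = degree M" by simp
  have "M = smult (lead_coeff M) (\<Prod>x\<in>?R g. [:- x, 1:])"
    using cardM roots finite_roots_unity[of g] \<open>g > 0\<close>
    by (intro poly_eq_prod_of_distinct_roots) auto
  also have "lead_coeff M = fls_const u"
    using u degM by (simp add: M_def coeff_map_poly)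
  finally have "poly M 0 = fls_const u * (\<Prod>s | s ^ g = 1. - rotation s \<gamma>)"
    using rotation_inj_on[OF \<gamma> \<open>g > 0\<close>] by (simp add: poly_prod prod.reindex)
  moreover have "poly M 0 = laurent_eval \<gamma> (coeff m 0)"
    by (simp add: M_def poly_0_coeff_0 coeff_map_poly)
  ultimately have W: "laurent_eval \<gamma> (coeff m 0) = laurent_eval (\<Prod>s | s ^ g = 1. - rotation s \<gamma>) [:0, u:]"
    by (simp add: laurent_eval_pCons mult.commute)
  note N = norm_of_rotations[OF \<gamma> \<open>g > 0\<close>]
  have "supported_on_multiples g (laurent_eval \<gamma> (coeff m 0))"
    unfolding W by (intro supported_on_multiples_laurent_eval \<open>g > 0\<close> N)
  moreover have "degree (coeff m 0) = g"
  proof -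
    have "fls_subdegree (laurent_eval \<gamma> (coeff m 0)) = - int g"
      unfolding W using laurent_eval_leading(1)[OF N(2) \<open>g > 0\<close>, of "[:0, u:]"] u0 by simp
    moreover from this have "coeff m 0 \<noteq> 0" using \<open>g > 0\<close> by auto
    ultimately show ?thesis using laurent_eval_leading(1)[OF \<gamma>1, of "coeff m 0"] by simp
  qed
  ultimately show ?thesis unfolding g_def by blast
qed

section \<open>The common left multiple for coprime degrees\<close>

lemma laurent_eval_fls_const: "laurent_eval (fls_const x) p = fls_const (poly p x)"
  by (induction p) (simp_all add: laurent_eval_pCons fls_plus_const)

lemma degree_prod_mset_const:
  fixes f :: "'b \<Rightarrow> 'a::idom poly"
  assumes "\<And>x. degree (f x) = d" "d > 0"
  shows "degree (\<Prod>x\<in>#A. f x) = size A * d \<and> (\<Prod>x\<in>#A. f x) \<noteq> 0"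
proof (induction A)
  case (add x A)
  have "f x \<noteq> 0" using assms(1)[of x] assms(2) by auto
  then show ?case using add assms(1)[of x] by (simp add: degree_mult_eq)
qed simp

text \<open>
  The norm of X1(z) from the polynomials in z to the polynomials in X2. Let the a range over the
  roots of X1 with multiplicity and s over the d2-th roots of unity, and let Y be the product of the
  factors X2(a) - X2. Evaluated at \<gamma>(t), each factor is a constant times the product over s of
  the \<gamma>(s t) - a. Exchanging the products, Y(\<gamma>(t)) is a constant times the product over
  s of X1(\<gamma>(s t)). The first description shows that Y is a polynomial in X2, hence supported on
  multiples of d2. In the second every factor is supported on multiples of d1, because rotations do
  not change supports.
\<close>

lemma coprime_degree_product_polynomial:
  assumes \<gamma>: "fls_subdegree \<gamma> = - 1"
    and X1: "degree X1 = d1" "d1 > 0" "supported_on_multiples d1 (laurent_eval \<gamma> X1)"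
    and X2: "degree X2 = d2" "d2 > 0" "supported_on_multiples d2 (laurent_eval \<gamma> X2)"
    and "coprime d1 d2"
  shows "\<exists>Y. degree Y = d1 * d2 \<and> supported_on_multiples (d1 * d2) (laurent_eval \<gamma> Y)"
proof -
  have l1: "lead_coeff X1 \<noteq> 0" using X1 by auto
  then obtain A where A: "size A = d1" "X1 = smult (lead_coeff X1) (\<Prod>x\<in>#A. [:- x, 1:])"
    using alg_closed_imp_factorization[of X1] X1 by auto
  define Q where "Q = (\<Prod>x\<in>#A. [:poly X2 x, -1:])"
  define Y where "Y = Q \<circ>\<^sub>p X2"
  have "degree Q = d1"
    unfolding Q_def using degree_prod_mset_const[of "\<lambda>x. [:poly X2 x, -1:]" 1 A] A(1) by simp
  then have degY: "degree Y = d1 * d2" using X2 by (simp add: Y_def degree_pcompose)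
  let ?\<mu> = "{s::complex. s ^ d2 = 1}"
  have nz: "s \<noteq> 0" if "s \<in> ?\<mu>" for s using root_of_unity_nonzero[OF X2(2)] that by auto
  have factor: "\<exists>k. fls_const (poly X2 x) - laurent_eval \<gamma> X2
      = fls_const k * (\<Prod>s\<in>?\<mu>. rotation s \<gamma> - fls_const x)" for x
  proof -
    have "fls_const (poly X2 x) - laurent_eval \<gamma> X2 = poly (fiber_poly \<gamma> X2) (fls_const x)"
      by (simp add: poly_fiber_poly laurent_eval_fls_const)
    also have "\<dots> = fls_const (lead_coeff X2) * (\<Prod>s\<in>?\<mu>. fls_const x - rotation s \<gamma>)"
      unfolding fiber_poly_factorization[OF \<gamma> X2] by (simp add: poly_prod)
    also have "(\<Prod>s\<in>?\<mu>. fls_const x - rotation s \<gamma>)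
        = (\<Prod>s\<in>?\<mu>. fls_const (-1) * (rotation s \<gamma> - fls_const x))"
      by (intro prod.cong) simp_all
    also have "\<dots> = fls_const ((-1) ^ card ?\<mu>) * (\<Prod>s\<in>?\<mu>. rotation s \<gamma> - fls_const x)"
      by (simp only: prod.distrib prod_constant fls_const_power)
    finally show ?thesis
      by (intro exI[of _ "lead_coeff X2 * (-1) ^ card ?\<mu>"])
        (simp only: mult.assoc fls_const_mult_const[symmetric])
  qed
  have "\<exists>k. (\<Prod>x\<in>#C. fls_const (poly X2 x) - laurent_eval \<gamma> X2)
      = fls_const k * (\<Prod>s\<in>?\<mu>. \<Prod>x\<in>#C. rotation s \<gamma> - fls_const x)" for C
  proof (induction C)
    case empty
    show ?case by (intro exI[of _ 1]) simp
  next
    case (add x C)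
    then obtain k where k: "(\<Prod>x\<in>#C. fls_const (poly X2 x) - laurent_eval \<gamma> X2)
      = fls_const k * (\<Prod>s\<in>?\<mu>. \<Prod>x\<in>#C. rotation s \<gamma> - fls_const x)" by blast
    obtain j where j: "fls_const (poly X2 x) - laurent_eval \<gamma> X2
      = fls_const j * (\<Prod>s\<in>?\<mu>. rotation s \<gamma> - fls_const x)" using factor by blast
    show ?case
      by (intro exI[of _ "j * k"])
        (simp add: k j prod.distrib mult_ac flip: fls_const_mult_const)
  qed
  then obtain k where k: "(\<Prod>x\<in>#A. fls_const (poly X2 x) - laurent_eval \<gamma> X2)
      = fls_const k * (\<Prod>s\<in>?\<mu>. \<Prod>x\<in>#A. rotation s \<gamma> - fls_const x)" by blast
  have "laurent_eval \<gamma> Y = (\<Prod>x\<in>#A. fls_const (poly X2 x) - laurent_eval \<gamma> X2)"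
    unfolding Y_def Q_def laurent_eval_pcompose laurent_eval_prod_mset
    by (simp add: laurent_eval_pCons)
  also note k
  also have "(\<Prod>s\<in>?\<mu>. \<Prod>x\<in>#A. rotation s \<gamma> - fls_const x)
      = (\<Prod>s\<in>?\<mu>. laurent_eval (rotation s (laurent_eval \<gamma> X1)) [:0, 1 / lead_coeff X1:])"
  proof (rule prod.cong)
    fix s assume s: "s \<in> ?\<mu>"
    have "rotation s (laurent_eval \<gamma> X1) = laurent_eval (rotation s \<gamma>) X1"
      using nz[OF s] by (simp add: rotation_laurent_eval)
    also have "\<dots> = fls_const (lead_coeff X1) * (\<Prod>x\<in>#A. rotation s \<gamma> - fls_const x)"
      by (subst A(2)) (simp add: laurent_eval_smult laurent_eval_prod_mset laurent_eval_pCons)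
    finally show "(\<Prod>x\<in>#A. rotation s \<gamma> - fls_const x)
        = laurent_eval (rotation s (laurent_eval \<gamma> X1)) [:0, 1 / lead_coeff X1:]"
      using l1 by (simp add: laurent_eval_pCons mult_ac)
  qed simp
  finally have eq: "laurent_eval \<gamma> Y = laurent_eval (\<Prod>s\<in>?\<mu>.
      laurent_eval (rotation s (laurent_eval \<gamma> X1)) [:0, 1 / lead_coeff X1:]) [:0, k:]"
    by (simp add: laurent_eval_pCons mult.commute)
  have "supported_on_multiples d1 (laurent_eval \<gamma> Y)"
    unfolding eq by (intro supported_on_multiples_laurent_eval supported_on_multiples_prod
        supported_on_multiples_rotation X1 nz)
  moreover have "supported_on_multiples d2 (laurent_eval \<gamma> Y)"
    unfolding Y_def laurent_eval_pcompose by (intro supported_on_multiples_laurent_eval X2)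
  ultimately show ?thesis
    using degY supported_on_multiples_coprime[OF assms(8)] by blast
qed

section \<open>Lattice structure of semiconjugacies\<close>

lemma gcd_of_semiconjugacies:
  fixes B X1 X2 :: "complex poly"
  assumes "degree B \<ge> 2" "degree X1 > 0" "degree X2 > 0"
    and "\<exists>A. A \<circ>\<^sub>p X1 = X1 \<circ>\<^sub>p B" "\<exists>A. A \<circ>\<^sub>p X2 = X2 \<circ>\<^sub>p B"
  obtains W A V1 V2 where "degree W = gcd (degree X1) (degree X2)" "A \<circ>\<^sub>p W = W \<circ>\<^sub>p B"
    "X1 = V1 \<circ>\<^sub>p W" "X2 = V2 \<circ>\<^sub>p W"
proof -
  obtain \<gamma> where \<gamma>: "fls_subdegree \<gamma> = - 1" "laurent_eval \<gamma> B = fls_compose_power \<gamma> (degree B)"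
    using boettcher_coordinate_exists[OF refl assms(1)] by blast
  note iff = semiconjugacy_iff_supported_on_multiples[OF refl assms(1) \<gamma> refl]
  have S: "supported_on_multiples (degree X1) (laurent_eval \<gamma> X1)"
    "supported_on_multiples (degree X2) (laurent_eval \<gamma> X2)"
    using iff assms by blast+
  define g where "g = gcd (degree X1) (degree X2)"
  have g: "g > 0" using assms by (simp add: g_def)
  obtain W where W: "degree W = g" "supported_on_multiples g (laurent_eval \<gamma> W)"
    using gcd_degree_polynomial[OF \<gamma>(1) refl assms(2) S(1) refl assms(3) S(2)] by (auto simp: g_def)
  have Sg: "supported_on_multiples g (laurent_eval \<gamma> X1)" "supported_on_multiples g (laurent_eval \<gamma> X2)"
    using S by (auto simp: g_def intro: supported_on_multiples_dvd[rotated])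
  obtain V1 V2 where "X1 = V1 \<circ>\<^sub>p W" "X2 = V2 \<circ>\<^sub>p W"
    using decomposition_of_supported_on_multiples[OF \<gamma>(1) W(1) g W(2)] Sg by blast
  moreover obtain A where "A \<circ>\<^sub>p W = W \<circ>\<^sub>p B" using iff[of W] W g by auto
  ultimately show ?thesis using that W(1) by (simp add: g_def)
qed

lemma coprime_lcm_of_semiconjugacies:
  fixes B X1 X2 :: "complex poly"
  assumes "degree B \<ge> 2" "degree X1 > 0" "degree X2 > 0" "coprime (degree X1) (degree X2)"
    and "\<exists>A. A \<circ>\<^sub>p X1 = X1 \<circ>\<^sub>p B" "\<exists>A. A \<circ>\<^sub>p X2 = X2 \<circ>\<^sub>p B"
  obtains Y A U1 U2 where "degree Y = degree X1 * degree X2" "A \<circ>\<^sub>p Y = Y \<circ>\<^sub>p B"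
    "Y = U1 \<circ>\<^sub>p X1" "Y = U2 \<circ>\<^sub>p X2"
proof -
  obtain \<gamma> where \<gamma>: "fls_subdegree \<gamma> = - 1" "laurent_eval \<gamma> B = fls_compose_power \<gamma> (degree B)"
    using boettcher_coordinate_exists[OF refl assms(1)] by blast
  note iff = semiconjugacy_iff_supported_on_multiples[OF refl assms(1) \<gamma> refl]
  have S: "supported_on_multiples (degree X1) (laurent_eval \<gamma> X1)"
    "supported_on_multiples (degree X2) (laurent_eval \<gamma> X2)"
    using iff assms by blast+
  define l where "l = degree X1 * degree X2"
  have l: "l > 0" using assms by (simp add: l_def)
  obtain Y where Y: "degree Y = l" "supported_on_multiples l (laurent_eval \<gamma> Y)"
    using coprime_degree_product_polynomial[OF \<gamma>(1) refl assms(2) S(1) refl assms(3) S(2) assms(4)]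
    by (auto simp: l_def)
  have SY: "supported_on_multiples (degree X1) (laurent_eval \<gamma> Y)"
    "supported_on_multiples (degree X2) (laurent_eval \<gamma> Y)"
    using Y(2) by (auto simp: l_def intro: supported_on_multiples_dvd[rotated])
  obtain U1 U2 where "Y = U1 \<circ>\<^sub>p X1" "Y = U2 \<circ>\<^sub>p X2"
    using decomposition_of_supported_on_multiples[OF \<gamma>(1) refl assms(2) S(1) SY(1)]
      decomposition_of_supported_on_multiples[OF \<gamma>(1) refl assms(3) S(2) SY(2)] by blast
  moreover obtain A where "A \<circ>\<^sub>p Y = Y \<circ>\<^sub>p B" using iff[of Y] Y l by auto
  ultimately show ?thesis using that Y(1) by (simp add: l_def)
qed

lemma pcompose_right_cancel:
  fixes p q r :: "'a::idom poly"
  assumes "p \<circ>\<^sub>p r = q \<circ>\<^sub>p r" "degree r > 0"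
  shows "p = q"
proof -
  have "(p - q) \<circ>\<^sub>p r = 0" using assms(1) by (simp add: pcompose_diff)
  then show ?thesis using pcompose_eq_0[of "p - q" r] assms(2) by simp
qed

text \<open>
  Writing X1 = V1 o W and X2 = V2 o W with deg W the greatest common divisor of the degrees makes
  the degrees of V1 and V2 coprime. With A o W = W o B, cancelling W on the right shows that V1 and
  V2 are semiconjugacies for A, so the coprime case applies to them, with A in place of B.
\<close>

lemma lcm_of_semiconjugacies:
  fixes B X1 X2 :: "complex poly"
  assumes "degree B \<ge> 2" "degree X1 > 0" "degree X2 > 0"
    and "\<exists>A. A \<circ>\<^sub>p X1 = X1 \<circ>\<^sub>p B" "\<exists>A. A \<circ>\<^sub>p X2 = X2 \<circ>\<^sub>p B"
  obtains X A U1 U2 where "degree X = lcm (degree X1) (degree X2)" "A \<circ>\<^sub>p X = X \<circ>\<^sub>p B"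
    "X = U1 \<circ>\<^sub>p X1" "X = U2 \<circ>\<^sub>p X2"
proof -
  define g where "g = gcd (degree X1) (degree X2)"
  have g: "g > 0" using assms by (simp add: g_def)
  obtain W A V1 V2 where W: "degree W = g" and A: "A \<circ>\<^sub>p W = W \<circ>\<^sub>p B"
    and V: "X1 = V1 \<circ>\<^sub>p W" "X2 = V2 \<circ>\<^sub>p W"
    unfolding g_def by (rule gcd_of_semiconjugacies[OF assms])
  have degV: "degree X1 = degree V1 * g" "degree X2 = degree V2 * g"
    using V W by (simp_all add: degree_pcompose)
  have "degree A * g = g * degree B" using arg_cong[OF A, of degree] W by (simp add: degree_pcompose)
  then have degA: "degree A \<ge> 2" using g assms(1) by simp
  have semi: "\<exists>C. C \<circ>\<^sub>p V = V \<circ>\<^sub>p A" if ex: "\<exists>C. C \<circ>\<^sub>p (V \<circ>\<^sub>p W) = (V \<circ>\<^sub>p W) \<circ>\<^sub>p B" for V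
  proof -
    obtain C where C: "C \<circ>\<^sub>p (V \<circ>\<^sub>p W) = (V \<circ>\<^sub>p W) \<circ>\<^sub>p B" using ex by blast
    have "(C \<circ>\<^sub>p V) \<circ>\<^sub>p W = (V \<circ>\<^sub>p W) \<circ>\<^sub>p B" by (simp only: C pcompose_assoc[symmetric])
    also have "\<dots> = V \<circ>\<^sub>p (A \<circ>\<^sub>p W)" by (simp only: A pcompose_assoc[symmetric])
    also have "\<dots> = (V \<circ>\<^sub>p A) \<circ>\<^sub>p W" by (rule pcompose_assoc)
    finally have "(C \<circ>\<^sub>p V) \<circ>\<^sub>p W = (V \<circ>\<^sub>p A) \<circ>\<^sub>p W" .
    then have "C \<circ>\<^sub>p V = V \<circ>\<^sub>p A" by (rule pcompose_right_cancel) (simp add: W g)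
    then show ?thesis by blast
  qed
  have pos: "degree V1 > 0" "degree V2 > 0" using degV assms by (auto intro!: gr0I)
  have "gcd (degree V1) (degree V2) * g = g"
    by (metis degV g_def gcd_mult_distrib_nat mult.commute)
  then have cop: "coprime (degree V1) (degree V2)" using g by (simp add: coprime_iff_gcd_eq_1)
  obtain Y C U1 U2 where Y: "degree Y = degree V1 * degree V2" and C: "C \<circ>\<^sub>p Y = Y \<circ>\<^sub>p A"
    and U: "Y = U1 \<circ>\<^sub>p V1" "Y = U2 \<circ>\<^sub>p V2"
    by (rule coprime_lcm_of_semiconjugacies[OF degA pos cop])
      (use semi[of V1] semi[of V2] assms(4,5) V in simp_all)
  have "g * (degree V1 * degree V2 * g) = degree X1 * degree X2" by (simp add: degV mult_ac)
  also have "\<dots> = g * lcm (degree X1) (degree X2)" unfolding g_def by (rule prod_gcd_lcm_nat)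
  finally have "degree V1 * degree V2 * g = lcm (degree X1) (degree X2)" using g by simp
  then have "degree (Y \<circ>\<^sub>p W) = lcm (degree X1) (degree X2)"
    by (simp add: degree_pcompose Y W)
  moreover have "C \<circ>\<^sub>p (Y \<circ>\<^sub>p W) = (Y \<circ>\<^sub>p W) \<circ>\<^sub>p B"
  proof -
    have "C \<circ>\<^sub>p (Y \<circ>\<^sub>p W) = Y \<circ>\<^sub>p (A \<circ>\<^sub>p W)" by (simp only: C pcompose_assoc)
    also have "\<dots> = (Y \<circ>\<^sub>p W) \<circ>\<^sub>p B" by (simp only: A pcompose_assoc)
    finally show ?thesis .
  qed
  moreover have "Y \<circ>\<^sub>p W = U1 \<circ>\<^sub>p X1" by (simp only: U(1) V(1) pcompose_assoc)
  moreover have "Y \<circ>\<^sub>p W = U2 \<circ>\<^sub>p X2" by (simp only: U(2) V(2) pcompose_assoc)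
  ultimately show ?thesis by (rule that)
qed

theorem theorem1p2:
  fixes B X1 X2 :: "complex poly"
  assumes "degree B \<ge> 2"
    and "X1 \<in> E_set B"
    and "X2 \<in> E_set B"
  shows "(\<exists>X \<in> E_set B. degree X = lcm (degree X1) (degree X2) \<and>
            (\<exists>U1 U2. X = U1 \<circ>\<^sub>p X1 \<and> X = U2 \<circ>\<^sub>p X2)) \<and>
         (\<exists>W. (gcd (degree X1) (degree X2) \<ge> 2 \<longrightarrow> W \<in> E_set B) \<and>
            (\<exists>A. A \<circ>\<^sub>p W = W \<circ>\<^sub>p B) \<and>
            degree W = gcd (degree X1) (degree X2) \<and>
            (\<exists>V1 V2. X1 = V1 \<circ>\<^sub>p W \<and> X2 = V2 \<circ>\<^sub>p W))"
proof -
  have pos: "degree X1 > 0" "degree X2 > 0" and two: "degree X1 \<ge> 2"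
    and semi: "\<exists>A. A \<circ>\<^sub>p X1 = X1 \<circ>\<^sub>p B" "\<exists>A. A \<circ>\<^sub>p X2 = X2 \<circ>\<^sub>p B"
    using assms by (auto simp: E_set_def)
  obtain X A U1 U2 where X: "degree X = lcm (degree X1) (degree X2)" "A \<circ>\<^sub>p X = X \<circ>\<^sub>p B"
    "X = U1 \<circ>\<^sub>p X1" "X = U2 \<circ>\<^sub>p X2"
    by (rule lcm_of_semiconjugacies[OF assms(1) pos semi])
  obtain W A' V1 V2 where W: "degree W = gcd (degree X1) (degree X2)" "A' \<circ>\<^sub>p W = W \<circ>\<^sub>p B"
    "X1 = V1 \<circ>\<^sub>p W" "X2 = V2 \<circ>\<^sub>p W"
    by (rule gcd_of_semiconjugacies[OF assms(1) pos semi])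
  have "degree X1 \<le> degree X"
    unfolding X(1) using pos by (intro dvd_imp_le) (auto intro: lcm_pos_nat)
  then have "X \<in> E_set B" using two X(2) by (auto simp: E_set_def)
  moreover have "gcd (degree X1) (degree X2) \<ge> 2 \<longrightarrow> W \<in> E_set B"
    using W(1,2) by (auto simp: E_set_def)
  ultimately show ?thesis using X(1,3,4) W by blast
qed

end
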